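(* Up to isomorphism of categories (not necessarily preserving an ordering of the objects) there are exactly five reduced categories associated to the matrix $M_2^3$; that is, $\mathcal{C}ard(M_2^3,r)=5$.
   Context: $M_2^3$ is the $3\times 3$ matrix all of whose coefficients equal $2$. A category is associated to $M_2^3$ if it has exactly three objects $\lambda^1,\lambda^2,\lambda^3$ and each hom set $\mathcal{A}(\lambda^i,\lambda^j)$, $i,j\in\{1,2,3\}$ (including $i=j$), has exactly $2$ elements. It is reduced if no two distinct objects are isomorphic. An isomorphism of categories is a functor that is bijective on objects and on morphisms. $\mathcal{C}ard(M_2^3,r)$ is the number of isomorphism classes of reduced categories associated to $M_2^3$. *)

theory Defs
  imports "HOL-Analysis.Finite_Cartesian_Product"
begin

record ('o, 'm) cat =
  Ob :: "'o set"
  Arr :: "'m set"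
  Dom :: "'m \<Rightarrow> 'o"
  Cod :: "'m \<Rightarrow> 'o"
  Id :: "'o \<Rightarrow> 'm"
  Comp :: "'m \<Rightarrow> 'm \<Rightarrow> 'm"  \<comment> \<open>\<open>Comp C g f\<close> is \<open>g\<close> after \<open>f\<close>\<close>

definition Hom :: "('o, 'm) cat \<Rightarrow> 'o \<Rightarrow> 'o \<Rightarrow> 'm set" where
  "Hom C x y = {f \<in> Arr C. Dom C f = x \<and> Cod C f = y}"

locale category =
  fixes C :: "('o, 'm) cat"
  assumes Dom_in_Ob: "f \<in> Arr C \<Longrightarrow> Dom C f \<in> Ob C"
    and Cod_in_Ob: "f \<in> Arr C \<Longrightarrow> Cod C f \<in> Ob C"
    and Id_in_Hom: "x \<in> Ob C \<Longrightarrow> Id C x \<in> Hom C x x"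
    and Comp_in_Hom: "f \<in> Hom C x y \<Longrightarrow> g \<in> Hom C y z \<Longrightarrow> Comp C g f \<in> Hom C x z"
    and Comp_Id_right: "f \<in> Hom C x y \<Longrightarrow> Comp C f (Id C x) = f"
    and Comp_Id_left: "f \<in> Hom C x y \<Longrightarrow> Comp C (Id C y) f = f"
    and Comp_assoc: "f \<in> Hom C w x \<Longrightarrow> g \<in> Hom C x y \<Longrightarrow> h \<in> Hom C y z \<Longrightarrow>
          Comp C h (Comp C g f) = Comp C (Comp C h g) f"

definition isomorphic_objects :: "('o, 'm) cat \<Rightarrow> 'o \<Rightarrow> 'o \<Rightarrow> bool" where
  "isomorphic_objects C x y \<longleftrightarrow>
     (\<exists>f \<in> Hom C x y. \<exists>g \<in> Hom C y x. Comp C g f = Id C x \<and> Comp C f g = Id C y)"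

definition reduced :: "('o, 'm) cat \<Rightarrow> bool" where
  "reduced C \<longleftrightarrow> (\<forall>x \<in> Ob C. \<forall>y \<in> Ob C. x \<noteq> y \<longrightarrow> \<not> isomorphic_objects C x y)"

locale cat_functor = C: category C + D: category D
  for C :: "('o, 'm) cat" and D :: "('p, 'n) cat" +
  fixes Fo :: "'o \<Rightarrow> 'p" and Fa :: "'m \<Rightarrow> 'n"
  assumes Fo_in_Ob: "x \<in> Ob C \<Longrightarrow> Fo x \<in> Ob D"
    and Fa_in_Hom: "f \<in> Hom C x y \<Longrightarrow> Fa f \<in> Hom D (Fo x) (Fo y)"
    and Fa_Id: "x \<in> Ob C \<Longrightarrow> Fa (Id C x) = Id D (Fo x)"
    and Fa_Comp: "f \<in> Hom C x y \<Longrightarrow> g \<in> Hom C y z \<Longrightarrow>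
          Fa (Comp C g f) = Comp D (Fa g) (Fa f)"

definition isomorphic_cats :: "('o, 'm) cat \<Rightarrow> ('p, 'n) cat \<Rightarrow> bool" where
  "isomorphic_cats C D \<longleftrightarrow>
     (\<exists>Fo Fa. cat_functor C D Fo Fa \<and> bij_betw Fo (Ob C) (Ob D) \<and> bij_betw Fa (Arr C) (Arr D))"

text \<open>
  The entry \<open>M $ i $ j\<close> is the number of arrows from the \<open>i\<close>-th to the \<open>j\<close>-th object.
  The enumeration of the objects is existentially quantified, so it is not part of the
  structure that an isomorphism has to preserve. Finiteness of the hom sets is explicit
  because \<open>card\<close> is 0 on infinite sets.
\<close>

definition associated :: "nat ^ 'n ^ 'n \<Rightarrow> ('o, 'm) cat \<Rightarrow> bool" where
  "associated M C \<longleftrightarrow> category C \<and>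
     (\<exists>l :: 'n \<Rightarrow> 'o. bij_betw l UNIV (Ob C) \<and>
       (\<forall>i j. finite (Hom C (l i) (l j)) \<and> card (Hom C (l i) (l j)) = M $ i $ j))"

definition reduced_cats :: "nat ^ 'n ^ 'n \<Rightarrow> ('o, 'm) cat set" where
  "reduced_cats M = {C. associated M C \<and> reduced C}"

text \<open>
  A category associated to a finite matrix is finite, hence isomorphic to one whose objects
  and arrows are natural numbers. Isomorphism classes can thus be counted on that type.
\<close>

definition Card_reduced :: "nat ^ 'n ^ 'n \<Rightarrow> nat" where
  "Card_reduced M =
     card ((reduced_cats M :: (nat, nat) cat set) //
           {(C, D). C \<in> reduced_cats M \<and> D \<in> reduced_cats M \<and> isomorphic_cats C D})"

definition M23 :: "nat ^ 3 ^ 3" where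
  "M23 = (\<chi> i j. 2)"

end

theory Submission
  imports Defs "HOL-Library.Countable"
begin

text \<open>
  In a reduced category with two arrows in every hom set, no object is a retract of another one
  (\<open>no_retract\<close>), so every loop \<open>x \<rightarrow> y \<rightarrow> x\<close> through
  \<open>y \<noteq> x\<close> is the one non-identity endomorphism of \<open>x\<close>. Inserting such a loop into a composite
  shows that the non-identity endomorphisms are idempotent and send both arrows of a hom set to
  the same arrow (\<open>nonid_const\<close>). Hence the category has zero arrows, and every hom set consists
  of a zero and of exactly one nonzero arrow \<open>a\<^sub>x\<^sub>y\<close>, with \<open>a\<^sub>x\<^sub>x\<close> the identity and
  \<open>a\<^sub>y\<^sub>x a\<^sub>x\<^sub>y\<close> zero.

  With three objects the composition is therefore determined by the set \<open>T\<close> of those orderings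
  \<open>(x, y, z)\<close> of the objects for which \<open>a\<^sub>y\<^sub>z a\<^sub>x\<^sub>y\<close> is nonzero, that is, equal to \<open>a\<^sub>x\<^sub>z\<close>.
  Associativity says exactly that \<open>T\<close> never contains two orderings that differ by exchanging the
  first two or the last two objects: one half of this is \<open>no_first_swap\<close> and \<open>no_last_swap\<close>, the
  other is \<open>composite_nonzero_assoc\<close>, by which every such \<open>T\<close> does come from a category. The six
  orderings with these exchanges as edges form a hexagon

  \<open>012 - 102 - 120 - 210 - 201 - 021 - 012\<close>,

  and \<open>T\<close> is an independent set of it. An isomorphism of categories preserves zeros, so isomorphism
  classes correspond to the orbits of independent sets under renaming the three objects. Renaming
  acts on the hexagon simply transitively, and the 18 independent sets fall into five orbits: the
  empty set, one vertex, two vertices at distance two, two opposite vertices, and three alternate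
  vertices. The number of vertices, together with whether two of them are opposite (reverse
  orderings of each other), tells the orbits apart.
\<close>

section \<open>Isomorphism of categories is an equivalence relation\<close>

lemma isomorphic_cats_refl:
  assumes "category C"
  shows "isomorphic_cats C C"
proof -
  interpret category C by fact
  have "cat_functor C C id id"
    by unfold_locales auto
  then show ?thesis
    unfolding isomorphic_cats_def using bij_betw_id by blast
qed

lemma isomorphic_cats_trans:
  assumes "isomorphic_cats C D" "isomorphic_cats D E"
  shows "isomorphic_cats C E"
proof -
  obtain Fo Fa where F: "cat_functor C D Fo Fa"
    and bF: "bij_betw Fo (Ob C) (Ob D)" "bij_betw Fa (Arr C) (Arr D)"
    using assms(1) unfolding isomorphic_cats_def by blast
  obtain Go Ga where G: "cat_functor D E Go Ga"
    and bG: "bij_betw Go (Ob D) (Ob E)" "bij_betw Ga (Arr D) (Arr E)"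
    using assms(2) unfolding isomorphic_cats_def by blast
  interpret F: cat_functor C D Fo Fa by fact
  interpret G: cat_functor D E Go Ga by fact
  have "cat_functor C E (Go \<circ> Fo) (Ga \<circ> Fa)"
  proof
    show "(Ga \<circ> Fa) (Comp C g f) = Comp E ((Ga \<circ> Fa) g) ((Ga \<circ> Fa) f)"
      if "f \<in> Hom C x y" "g \<in> Hom C y z" for f g x y z
      using F.Fa_Comp[OF that] G.Fa_Comp[OF that[THEN F.Fa_in_Hom]] by simp
  qed (simp_all add: F.Fo_in_Ob G.Fo_in_Ob F.Fa_in_Hom G.Fa_in_Hom F.Fa_Id G.Fa_Id)
  moreover have "bij_betw (Go \<circ> Fo) (Ob C) (Ob E)" "bij_betw (Ga \<circ> Fa) (Arr C) (Arr E)"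
    using bF bG by (simp_all add: bij_betw_trans)
  ultimately show ?thesis
    unfolding isomorphic_cats_def by blast
qed

lemma isomorphic_cats_sym:
  assumes "isomorphic_cats C D"
  shows "isomorphic_cats D C"
proof -
  obtain Fo Fa where F: "cat_functor C D Fo Fa"
    and bo: "bij_betw Fo (Ob C) (Ob D)" and ba: "bij_betw Fa (Arr C) (Arr D)"
    using assms unfolding isomorphic_cats_def by blast
  interpret F: cat_functor C D Fo Fa by fact
  define Go where "Go = inv_into (Ob C) Fo"
  define Ga where "Ga = inv_into (Arr C) Fa"
  have Go_Fo: "Go (Fo x) = x" if "x \<in> Ob C" for x
    using that bo unfolding Go_def by (simp add: bij_betw_inv_into_left)
  have Fo_Go: "Fo (Go u) = u" "Go u \<in> Ob C" if "u \<in> Ob D" for u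
    using that bo unfolding Go_def
    by (simp_all add: bij_betw_inv_into_right bij_betw_imp_surj_on inv_into_into)
  have Ga_Fa: "Ga (Fa f) = f" if "f \<in> Hom C x y" for f x y
    using that ba unfolding Ga_def Hom_def by (simp add: bij_betw_inv_into_left)
  \<comment> \<open>Injectivity of \<open>Fo\<close> fixes the domain and codomain of a preimage of an arrow, so \<open>Fa\<close>, bijective
    only on all arrows together, is onto on every single hom set.\<close>
  have arrow_image: "\<exists>f \<in> Hom C (Go u) (Go v). g = Fa f" if g: "g \<in> Hom D u v" for g u v
  proof -
    obtain f where f: "f \<in> Arr C" "g = Fa f"
      using g ba unfolding Hom_def bij_betw_def by blast
    have fH: "f \<in> Hom C (Dom C f) (Cod C f)"
      using f by (simp add: Hom_def)
    then have "u = Fo (Dom C f)" "v = Fo (Cod C f)"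
      using F.Fa_in_Hom[OF fH] g f(2) by (auto simp: Hom_def)
    then show ?thesis
      using fH f Go_Fo F.C.Dom_in_Ob F.C.Cod_in_Ob by auto
  qed
  have "cat_functor D C Go Ga"
  proof
    show "Go u \<in> Ob C" if "u \<in> Ob D" for u
      using that by (rule Fo_Go)
    show "Ga g \<in> Hom C (Go u) (Go v)" if "g \<in> Hom D u v" for g u v
      using arrow_image[OF that] Ga_Fa by auto
    show "Ga (Id D u) = Id C (Go u)" if "u \<in> Ob D" for u
      using F.Fa_Id[of "Go u"] Ga_Fa[OF F.C.Id_in_Hom, of "Go u"] Fo_Go[OF that] by simp
    show "Ga (Comp D h g) = Comp C (Ga h) (Ga g)"
      if gh: "g \<in> Hom D u v" "h \<in> Hom D v w" for g h u v w
    proof -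
      obtain f where f: "f \<in> Hom C (Go u) (Go v)" "g = Fa f" using arrow_image gh by blast
      obtain k where k: "k \<in> Hom C (Go v) (Go w)" "h = Fa k" using arrow_image gh by blast
      have "Comp D h g = Fa (Comp C k f)" using F.Fa_Comp f k by simp
      then show ?thesis
        using Ga_Fa F.C.Comp_in_Hom f k by metis
    qed
  qed
  moreover have "bij_betw Go (Ob D) (Ob C)" "bij_betw Ga (Arr D) (Arr C)"
    using bo ba unfolding Go_def Ga_def by (auto intro: bij_betw_inv_into)
  ultimately show ?thesis
    unfolding isomorphic_cats_def by blast
qed

lemma card_quotient_representatives:
  assumes eq: "equiv A r" and sub: "S \<subseteq> A"
    and distinct: "\<And>x y. x \<in> S \<Longrightarrow> y \<in> S \<Longrightarrow> (x, y) \<in> r \<Longrightarrow> x = y"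
    and cover: "\<And>x. x \<in> A \<Longrightarrow> \<exists>y\<in>S. (x, y) \<in> r"
  shows "card (A // r) = card S"
proof -
  have "inj_on (\<lambda>x. r `` {x}) S"
    using distinct sub eq by (meson eq_equiv_class inj_onI subsetD)
  moreover have "(\<lambda>x. r `` {x}) ` S = A // r"
  proof
    show "(\<lambda>x. r `` {x}) ` S \<subseteq> A // r"
      using sub by (auto intro: quotientI)
    show "A // r \<subseteq> (\<lambda>x. r `` {x}) ` S"
    proof
      fix X assume "X \<in> A // r"
      then obtain x where x: "x \<in> A" "X = r `` {x}" by (auto elim: quotientE)
      then obtain y where "y \<in> S" "(x, y) \<in> r" using cover by blast
      then show "X \<in> (\<lambda>x. r `` {x}) ` S"
        using equiv_class_eq[OF eq] x by blast
    qed
  qed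
  ultimately show ?thesis
    by (metis card_image)
qed


section \<open>Reduced categories with two arrows in every hom set\<close>

locale two_arrow_category = category C for C :: "('o, 'm) cat" +
  assumes card_Hom: "x \<in> Ob C \<Longrightarrow> y \<in> Ob C \<Longrightarrow> card (Hom C x y) = 2"
    and reduced: "reduced C"
    and other_object: "x \<in> Ob C \<Longrightarrow> \<exists>y \<in> Ob C. y \<noteq> x"
begin

abbreviation comp (infixr "\<cdot>" 70) where "g \<cdot> f \<equiv> Comp C g f"

lemma Hom_nonempty:
  assumes "x \<in> Ob C" "y \<in> Ob C"
  shows "\<exists>f. f \<in> Hom C x y"
  using card_Hom[OF assms] by (metis card.empty equals0I zero_neq_numeral)

lemma Hom_two:
  assumes "x \<in> Ob C" "y \<in> Ob C" "f \<in> Hom C x y"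
  shows "\<exists>g. g \<noteq> f \<and> Hom C x y = {f, g}"
  using card_Hom[OF assms(1,2)] assms(3) by (auto simp: card_2_iff)

lemma Hom_Ob:
  assumes "f \<in> Hom C x y"
  shows "x \<in> Ob C" "y \<in> Ob C"
  using assms Dom_in_Ob Cod_in_Ob by (auto simp: Hom_def)

text \<open>
  If \<open>h \<cdot> f = Id C x\<close>, then \<open>f \<cdot> h\<close> is an idempotent of \<open>y\<close>, and not the identity as \<open>C\<close> is
  reduced; so it is the second endomorphism of \<open>y\<close>. The map \<open>g \<mapsto> f \<cdot> g \<cdot> h\<close> from the endomorphisms
  of \<open>x\<close> to those of \<open>y\<close> is injective and misses \<open>Id C y\<close>, which leaves room for only one
  endomorphism of \<open>x\<close>.
\<close>

lemma no_retract:
  assumes f: "f \<in> Hom C x y" and h: "h \<in> Hom C y x" and "x \<noteq> y"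
  shows "h \<cdot> f \<noteq> Id C x"
proof
  assume hf: "h \<cdot> f = Id C x"
  note Ob = Hom_Ob[OF f]
  have fh: "f \<cdot> h \<in> Hom C y y" using f h Comp_in_Hom by blast
  have fh1: "f \<cdot> h \<noteq> Id C y"
    using reduced Ob \<open>x \<noteq> y\<close> f h hf unfolding reduced_def isomorphic_objects_def by blast
  obtain p where "p \<noteq> Id C y" "Hom C y y = {Id C y, p}"
    using Hom_two[OF Ob(2) Ob(2) Id_in_Hom] Ob by blast
  then have End_y: "Hom C y y = {Id C y, f \<cdot> h}" using fh fh1 by auto
  have "g = Id C x" if g: "g \<in> Hom C x x" for g
  proof -
    have gh: "g \<cdot> h \<in> Hom C y x" using g h Comp_in_Hom by blast
    have hfgh: "h \<cdot> (f \<cdot> (g \<cdot> h)) = g \<cdot> h"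
      using Comp_assoc[OF gh f h] hf Comp_Id_left[OF gh] by simp
    have "f \<cdot> (g \<cdot> h) \<in> Hom C y y" using gh f Comp_in_Hom by blast
    then consider "f \<cdot> (g \<cdot> h) = Id C y" | "f \<cdot> (g \<cdot> h) = f \<cdot> h" using End_y by blast
    then show ?thesis
    proof cases
      case 1
      then have "g \<cdot> h = h" using hfgh Comp_Id_right[OF h] by simp
      then show ?thesis using 1 fh1 by simp
    next
      case 2
      have "g \<cdot> h = h"
        using hfgh 2 Comp_assoc[OF h f h] hf Comp_Id_left[OF h] by simp
      then have "g \<cdot> (h \<cdot> f) = h \<cdot> f" using Comp_assoc[OF f h g] by simp
      then show ?thesis using hf Comp_Id_right[OF g] by simp
    qed
  qed
  then have "Hom C x x = {Id C x}" using Id_in_Hom Ob by blast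
  then show False using card_Hom[OF Ob(1) Ob(1)] by simp
qed

definition nonid where "nonid x = (SOME f. f \<in> Hom C x x \<and> f \<noteq> Id C x)"

lemma End_eq:
  assumes "x \<in> Ob C"
  shows "Hom C x x = {Id C x, nonid x}" "nonid x \<noteq> Id C x" "nonid x \<in> Hom C x x"
proof -
  obtain g where g: "g \<noteq> Id C x" "Hom C x x = {Id C x, g}"
    using Hom_two[OF assms assms Id_in_Hom[OF assms]] by blast
  have nonid: "nonid x \<in> Hom C x x \<and> nonid x \<noteq> Id C x"
    unfolding nonid_def by (rule someI[of _ g]) (use g in simp)
  then have "nonid x = g" using g(2) by blast
  with g nonid show "Hom C x x = {Id C x, nonid x}" "nonid x \<noteq> Id C x" "nonid x \<in> Hom C x x"
    by simp_all
qed

lemma loop: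
  assumes "f \<in> Hom C x y" "h \<in> Hom C y x" "x \<noteq> y"
  shows "h \<cdot> f = nonid x"
  using no_retract[OF assms] Comp_in_Hom[OF assms(1,2)] End_eq[OF Hom_Ob(1)[OF assms(1)]]
  by auto

text \<open>
  This rules out that the endomorphisms of \<open>x\<close> form a group of order two: the square of \<open>nonid x\<close> is
  again a loop through another object once one factor is written as such a loop.
\<close>

lemma nonid_idem:
  assumes "x \<in> Ob C"
  shows "nonid x \<cdot> nonid x = nonid x"
proof -
  obtain y where y: "y \<in> Ob C" "y \<noteq> x" using other_object assms by blast
  obtain f h where f: "f \<in> Hom C x y" and h: "h \<in> Hom C y x"
    using Hom_nonempty assms y by blast
  have ex: "nonid x \<in> Hom C x x" by (rule End_eq) fact
  have "nonid x \<cdot> nonid x = (h \<cdot> f) \<cdot> nonid x" using loop[OF f h] y by simp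
  also have "\<dots> = h \<cdot> (f \<cdot> nonid x)" using Comp_assoc[OF ex f h] by simp
  also have "\<dots> = nonid x" using loop[OF Comp_in_Hom[OF ex f] h] y by simp
  finally show ?thesis .
qed

text \<open>
  For \<open>x \<noteq> y\<close> both sides equal \<open>f \<cdot> h \<cdot> f'\<close> with an arbitrary \<open>h\<close> from \<open>y\<close> to \<open>x\<close>; for \<open>x = y\<close> the
  claim amounts to \<open>nonid_idem\<close>. Since \<open>f\<close> and \<open>f'\<close> are
  independent of each other, the common value depends on \<open>x\<close> and \<open>y\<close> only.
\<close>

lemma nonid_const:
  assumes f: "f \<in> Hom C x y" and f': "f' \<in> Hom C x y"
  shows "nonid y \<cdot> f' = f \<cdot> nonid x"
proof (cases "x = y")
  case True
  have x: "x \<in> Ob C" using Hom_Ob f by blast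
  have "k \<in> Hom C x x \<Longrightarrow> nonid x \<cdot> k = nonid x \<and> k \<cdot> nonid x = nonid x" for k
    using End_eq[OF x] nonid_idem[OF x] Comp_Id_left Comp_Id_right by (metis insertE singletonD)
  then show ?thesis using True f f' by simp
next
  case False
  obtain h where h: "h \<in> Hom C y x" using Hom_nonempty Hom_Ob f by blast
  have "nonid y \<cdot> f' = (f \<cdot> h) \<cdot> f'" using loop[OF h f] False by simp
  also have "\<dots> = f \<cdot> (h \<cdot> f')" using Comp_assoc[OF f' h f] by simp
  also have "\<dots> = f \<cdot> nonid x" using loop[OF f' h] False by simp
  finally show ?thesis .
qed

text \<open>
  The value is independent of the chosen arrow, by \<open>nonid_const\<close>.
\<close>

definition zero where "zero x y = nonid y \<cdot> (SOME f. f \<in> Hom C x y)"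

lemma Comp_nonid:
  assumes f: "f \<in> Hom C x y"
  shows "nonid y \<cdot> f = zero x y" "f \<cdot> nonid x = zero x y"
proof -
  have "(SOME f. f \<in> Hom C x y) \<in> Hom C x y" using f by (rule someI)
  then show "nonid y \<cdot> f = zero x y" "f \<cdot> nonid x = zero x y"
    unfolding zero_def using nonid_const f by metis+
qed

lemma zero_in_Hom:
  assumes "x \<in> Ob C" "y \<in> Ob C"
  shows "zero x y \<in> Hom C x y"
  using Hom_nonempty[OF assms] Comp_nonid(1) Comp_in_Hom End_eq(3)[OF assms(2)] by metis

lemma zero_self:
  assumes "x \<in> Ob C"
  shows "zero x x = nonid x"
  using Comp_nonid(1)[OF End_eq(3)[OF assms]] nonid_idem[OF assms] by simp

lemma Comp_zero:
  assumes x: "x \<in> Ob C" and g: "g \<in> Hom C y z"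
  shows "g \<cdot> zero x y = zero x z"
proof -
  obtain f where f: "f \<in> Hom C x y" using Hom_nonempty x Hom_Ob g by blast
  have "g \<cdot> zero x y = (g \<cdot> f) \<cdot> nonid x"
    using Comp_assoc[OF End_eq(3)[OF x] f g] Comp_nonid[OF f] by simp
  then show ?thesis using Comp_nonid(2)[OF Comp_in_Hom[OF f g]] by simp
qed

lemma zero_Comp:
  assumes f: "f \<in> Hom C x y" and z: "z \<in> Ob C"
  shows "zero y z \<cdot> f = zero x z"
proof -
  obtain g where g: "g \<in> Hom C y z" using Hom_nonempty z Hom_Ob f by blast
  have "zero y z \<cdot> f = nonid z \<cdot> (g \<cdot> f)"
    using Comp_assoc[OF f g End_eq(3)[OF z]] Comp_nonid[OF g] by simp
  then show ?thesis using Comp_nonid(1)[OF Comp_in_Hom[OF f g]] by simp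
qed

definition nonzero_arrow where "nonzero_arrow x y = (SOME f. f \<in> Hom C x y \<and> f \<noteq> zero x y)"

lemma Hom_eq:
  assumes "x \<in> Ob C" "y \<in> Ob C"
  shows "Hom C x y = {zero x y, nonzero_arrow x y}"
    "nonzero_arrow x y \<noteq> zero x y"
    "nonzero_arrow x y \<in> Hom C x y"
proof -
  obtain g where g: "g \<noteq> zero x y" "Hom C x y = {zero x y, g}"
    using Hom_two[OF assms zero_in_Hom[OF assms]] by blast
  have nonzero_arrow: "nonzero_arrow x y \<in> Hom C x y \<and> nonzero_arrow x y \<noteq> zero x y"
    unfolding nonzero_arrow_def by (rule someI[of _ g]) (use g in simp)
  then have "nonzero_arrow x y = g" using g(2) by blast
  with g nonzero_arrow show "Hom C x y = {zero x y, nonzero_arrow x y}"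
    "nonzero_arrow x y \<noteq> zero x y"
    "nonzero_arrow x y \<in> Hom C x y"
    by simp_all
qed

lemma nonzero_arrow_self:
  assumes "x \<in> Ob C"
  shows "nonzero_arrow x x = Id C x"
  using End_eq[OF assms] Hom_eq[OF assms assms] zero_self[OF assms] by auto

lemma nonzero_arrow_loop:
  assumes "x \<in> Ob C" "y \<in> Ob C" "x \<noteq> y"
  shows "nonzero_arrow y x \<cdot> nonzero_arrow x y = zero x x"
  using loop Hom_eq(3) zero_self assms by metis

text \<open>
  Otherwise the composite \<open>x \<rightarrow> y \<rightarrow> z \<rightarrow> y\<close> of nonzero arrows would be nonzero when bracketed to the
  right, whereas it contains the loop \<open>y \<rightarrow> z \<rightarrow> y\<close>, which is zero.
\<close>

lemma no_last_swap:
  assumes Ob: "x \<in> Ob C" "y \<in> Ob C" "z \<in> Ob C" and "y \<noteq> z"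
    and "nonzero_arrow y z \<cdot> nonzero_arrow x y = nonzero_arrow x z"
  shows "nonzero_arrow z y \<cdot> nonzero_arrow x z \<noteq> nonzero_arrow x y"
proof -
  have "nonzero_arrow z y \<cdot> nonzero_arrow x z = (nonzero_arrow z y \<cdot> nonzero_arrow y z) \<cdot> nonzero_arrow x y"
    using Comp_assoc[OF Hom_eq(3) Hom_eq(3) Hom_eq(3)] assms by metis
  also have "\<dots> = zero x y"
    using nonzero_arrow_loop zero_Comp[OF Hom_eq(3)] assms by simp
  finally show ?thesis using Hom_eq(2) Ob by metis
qed

lemma no_first_swap:
  assumes Ob: "x \<in> Ob C" "y \<in> Ob C" "z \<in> Ob C" and "x \<noteq> y"
    and "nonzero_arrow y z \<cdot> nonzero_arrow x y = nonzero_arrow x z"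
  shows "nonzero_arrow x z \<cdot> nonzero_arrow y x \<noteq> nonzero_arrow y z"
proof -
  have "nonzero_arrow x z \<cdot> nonzero_arrow y x = nonzero_arrow y z \<cdot> (nonzero_arrow x y \<cdot> nonzero_arrow y x)"
    using Comp_assoc[OF Hom_eq(3) Hom_eq(3) Hom_eq(3)] assms by metis
  also have "\<dots> = zero y z"
    using nonzero_arrow_loop Comp_zero Hom_eq(3) assms by simp
  finally show ?thesis using Hom_eq(2) Ob by metis
qed

end


section \<open>The category given by a set of composable triples\<close>

text \<open>
  These are the independent sets of the hexagon of orderings of \<open>0, 1, 2\<close>.
\<close>

definition compatible :: "(nat \<times> nat \<times> nat) set \<Rightarrow> bool" where
  "compatible T \<longleftrightarrow> (\<forall>(x, y, z) \<in> T.
     x < 3 \<and> y < 3 \<and> z < 3 \<and> x \<noteq> y \<and> y \<noteq> z \<and> x \<noteq> z \<and> (x, z, y) \<notin> T \<and> (y, x, z) \<notin> T)"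

lemma compatibleD:
  assumes "compatible T" "(x, y, z) \<in> T"
  shows "x < 3" "y < 3" "z < 3" "x \<noteq> y" "y \<noteq> z" "x \<noteq> z" "(x, z, y) \<notin> T" "(y, x, z) \<notin> T"
  using assms unfolding compatible_def by auto

text \<open>
  The arrow from \<open>x\<close> to \<open>y\<close> is nonzero if \<open>b\<close> holds, and zero otherwise. Arrows are coded as
  natural numbers because isomorphism classes are counted on that type.
\<close>

definition arrow :: "nat \<Rightarrow> nat \<Rightarrow> bool \<Rightarrow> nat" where
  "arrow x y b = to_nat (x, y, b)"

definition source :: "nat \<Rightarrow> nat" where
  "source f = (case from_nat f :: nat \<times> nat \<times> bool of (x, y, b) \<Rightarrow> x)"

definition target :: "nat \<Rightarrow> nat" where
  "target f = (case from_nat f :: nat \<times> nat \<times> bool of (x, y, b) \<Rightarrow> y)"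

definition nonzero :: "nat \<Rightarrow> bool" where
  "nonzero f = (case from_nat f :: nat \<times> nat \<times> bool of (x, y, b) \<Rightarrow> b)"

lemma arrow_simps [simp]:
  "source (arrow x y b) = x" "target (arrow x y b) = y" "nonzero (arrow x y b) = b"
  "arrow x y b = arrow x' y' b' \<longleftrightarrow> x = x' \<and> y = y' \<and> b = b'"
  by (simp_all add: arrow_def source_def target_def nonzero_def)

text \<open>
  The condition under which the nonzero arrows \<open>x \<rightarrow> y\<close> and \<open>y \<rightarrow> z\<close> have a nonzero composite. The
  first two disjuncts account for identities.
\<close>

definition composite_nonzero :: "(nat \<times> nat \<times> nat) set \<Rightarrow> nat \<Rightarrow> nat \<Rightarrow> nat \<Rightarrow> bool" where
  "composite_nonzero T x y z \<longleftrightarrow> x = y \<or> y = z \<or> (x, y, z) \<in> T"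

definition model :: "(nat \<times> nat \<times> nat) set \<Rightarrow> (nat, nat) cat" where
  "model T = \<lparr>Ob = {..<3}, Arr = {arrow x y b |x y b. x < 3 \<and> y < 3},
     Dom = source, Cod = target, Id = (\<lambda>x. arrow x x True),
     Comp = (\<lambda>g f. arrow (source f) (target g)
       (nonzero f \<and> nonzero g \<and> composite_nonzero T (source f) (target f) (target g)))\<rparr>"

lemma model_simps [simp]:
  "Ob (model T) = {..<3}"
  "Arr (model T) = {arrow x y b |x y b. x < 3 \<and> y < 3}"
  "Id (model T) x = arrow x x True"
  "Comp (model T) (arrow y z c) (arrow x y b) = arrow x z (b \<and> c \<and> composite_nonzero T x y z)"
  by (simp_all add: model_def)

lemma in_Hom_model:
  "f \<in> Hom (model T) x y \<longleftrightarrow> x < 3 \<and> y < 3 \<and> (\<exists>b. f = arrow x y b)"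
  by (auto simp: Hom_def model_def)

text \<open>
  The two sides say that a composite \<open>w \<rightarrow> x \<rightarrow> y \<rightarrow> z\<close> of nonzero arrows is nonzero when it is
  bracketed in one way or in the other. Without identities both are false: with only three
  objects available, a nonzero composite would require \<open>z = x\<close> or \<open>w = y\<close>, and then two
  orderings in \<open>T\<close> that differ by an exchange of neighbours.
\<close>

lemma composite_nonzero_assoc:
  assumes T: "compatible T" and "w < 3" "x < 3" "y < 3" "z < 3"
  shows "composite_nonzero T w x y \<and> composite_nonzero T w y z \<longleftrightarrow>
    composite_nonzero T x y z \<and> composite_nonzero T w x z"
proof (cases "w = x \<or> x = y \<or> y = z")
  case True
  then show ?thesis by (auto simp: composite_nonzero_def)
next
  case False
  have "\<not> (composite_nonzero T w x y \<and> composite_nonzero T w y z)"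
  proof
    assume u: "composite_nonzero T w x y \<and> composite_nonzero T w y z"
    then have 1: "(w, x, y) \<in> T" using False by (simp add: composite_nonzero_def)
    then have 2: "(w, y, z) \<in> T"
      using u False compatibleD[OF T 1] by (auto simp: composite_nonzero_def)
    have "z = x" using compatibleD(1-6)[OF T 1] compatibleD(1-6)[OF T 2] by linarith
    then show False using compatibleD(7)[OF T 1] 2 by simp
  qed
  moreover have "\<not> (composite_nonzero T x y z \<and> composite_nonzero T w x z)"
  proof
    assume u: "composite_nonzero T x y z \<and> composite_nonzero T w x z"
    then have 1: "(x, y, z) \<in> T" using False by (simp add: composite_nonzero_def)
    then have 2: "(w, x, z) \<in> T"
      using u False compatibleD[OF T 1] by (auto simp: composite_nonzero_def)
    have "w = y" using compatibleD(1-6)[OF T 1] compatibleD(1-6)[OF T 2] by linarith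
    then show False using compatibleD(8)[OF T 1] 2 by simp
  qed
  ultimately show ?thesis by blast
qed

lemma category_model:
  assumes T: "compatible T"
  shows "category (model T)"
proof
  show "Comp (model T) h (Comp (model T) g f) = Comp (model T) (Comp (model T) h g) f"
    if "f \<in> Hom (model T) w x" "g \<in> Hom (model T) x y" "h \<in> Hom (model T) y z" for f g h w x y z
    using that composite_nonzero_assoc[OF T, of w x y z] by (auto simp: in_Hom_model)
  show "Dom (model T) f \<in> Ob (model T)" "Cod (model T) f \<in> Ob (model T)"
    if "f \<in> Arr (model T)" for f
    using that by (auto simp: model_def)
qed (auto simp: in_Hom_model composite_nonzero_def)

text \<open>
  Reducedness holds because an isomorphism between distinct \<open>x\<close> and \<open>y\<close> would need \<open>(x, y, x) \<in> T\<close>.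
\<close>

lemma model_in_reduced_cats:
  assumes T: "compatible T"
  shows "model T \<in> reduced_cats M23"
proof -
  have "card {..<3::nat} = CARD(3)" by simp
  then obtain l :: "3 \<Rightarrow> nat" where l: "bij_betw l UNIV {..<3}"
    by (metis finite_class.finite_UNIV finite_lessThan finite_same_card_bij)
  have Hom: "Hom (model T) x y = {arrow x y False, arrow x y True}" if "x < 3" "y < 3" for x y
    using that by (auto simp: in_Hom_model)
  have "l i < 3" for i using l by (auto simp: bij_betw_def)
  then have "associated M23 (model T)"
    unfolding associated_def using category_model[OF T] l
    by (intro conjI exI[of _ l]) (auto simp: Hom M23_def)
  moreover have "reduced (model T)"
    unfolding reduced_def isomorphic_objects_def
    using compatibleD(6)[OF T] by (fastforce simp: in_Hom_model composite_nonzero_def)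
  ultimately show ?thesis by (simp add: reduced_cats_def)
qed


section \<open>Every reduced category is a model\<close>

context two_arrow_category
begin

definition triples :: "(nat \<Rightarrow> 'o) \<Rightarrow> (nat \<times> nat \<times> nat) set" where
  "triples l = {(i, j, k). i < 3 \<and> j < 3 \<and> k < 3 \<and> i \<noteq> j \<and> j \<noteq> k \<and>
     nonzero_arrow (l j) (l k) \<cdot> nonzero_arrow (l i) (l j) = nonzero_arrow (l i) (l k)}"

text \<open>
  Triples \<open>(i, j, i)\<close> are absent because the corresponding loop is zero and not the identity;
  exchanges of neighbours are excluded by associativity.
\<close>

lemma compatible_triples:
  assumes l: "bij_betw l {..<3} (Ob C)"
  shows "compatible (triples l)"
proof -
  have Ob: "l i \<in> Ob C" if "i < 3" for i using l that by (auto simp: bij_betw_def)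
  have inj: "l i = l j \<longleftrightarrow> i = j" if "i < 3" "j < 3" for i j
    using l that by (auto simp: bij_betw_def inj_on_def)
  have "i < 3 \<and> j < 3 \<and> k < 3 \<and> i \<noteq> j \<and> j \<noteq> k \<and> i \<noteq> k \<and>
      (i, k, j) \<notin> triples l \<and> (j, i, k) \<notin> triples l"
    if t: "(i, j, k) \<in> triples l" for i j k
  proof -
    have "i < 3" "j < 3" "k < 3" "i \<noteq> j" "j \<noteq> k"
      and *: "nonzero_arrow (l j) (l k) \<cdot> nonzero_arrow (l i) (l j) = nonzero_arrow (l i) (l k)"
      using t by (auto simp: triples_def)
    moreover have "i \<noteq> k"
      using calculation nonzero_arrow_loop[of "l i" "l j"] Hom_eq(2)[of "l i" "l i"] Ob inj by metis
    moreover have "(i, k, j) \<notin> triples l" "(j, i, k) \<notin> triples l"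
      using calculation no_last_swap[of "l i" "l j" "l k"] no_first_swap[of "l i" "l j" "l k"]
      by (auto simp: triples_def Ob inj)
    ultimately show ?thesis by blast
  qed
  then show ?thesis unfolding compatible_def by blast
qed

text \<open>
  The enumeration \<open>l\<close> of the objects extends to a functor from the model to \<open>C\<close> that sends zeros to
  zeros and nonzero arrows to nonzero arrows. Renaming the objects is left to the choice of \<open>l\<close>.
\<close>

lemma isomorphic_model:
  assumes l: "bij_betw l {..<3} (Ob C)"
  shows "isomorphic_cats C (model (triples l))"
proof -
  let ?K = "model (triples l)"
  have Ob: "l i \<in> Ob C" if "i < 3" for i using l that by (auto simp: bij_betw_def)
  have inj: "l i = l j \<longleftrightarrow> i = j" if "i < 3" "j < 3" for i j
    using l that by (auto simp: bij_betw_def inj_on_def)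
  define v where "v b = (if b then nonzero_arrow else zero)" for b
  define F where "F f = v (nonzero f) (l (source f)) (l (target f))" for f
  have F: "F (arrow i j b) = v b (l i) (l j)" for i j b by (simp add: F_def)
  have v_Hom: "v b x y \<in> Hom C x y" if "x \<in> Ob C" "y \<in> Ob C" for b x y
    using that Hom_eq zero_in_Hom by (simp add: v_def)
  have Comp: "v c (l j) (l k) \<cdot> v b (l i) (l j) =
      v (b \<and> c \<and> composite_nonzero (triples l) i j k) (l i) (l k)"
    if ijk: "i < 3" "j < 3" "k < 3" for b c i j k
  proof (cases "b \<and> c")
    case False
    have "v c (l j) (l k) \<cdot> zero (l i) (l j) = zero (l i) (l k)"
      "zero (l j) (l k) \<cdot> v b (l i) (l j) = zero (l i) (l k)"
      using Comp_zero zero_Comp v_Hom Ob ijk by metis+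
    then show ?thesis using False by (auto simp: v_def split: if_splits)
  next
    case True
    consider "i = j" | "j = k" | "i \<noteq> j" "j \<noteq> k" by blast
    then show ?thesis
    proof cases
      case 1
      then show ?thesis using True nonzero_arrow_self[OF Ob] Comp_Id_right[OF Hom_eq(3)[OF Ob Ob]] ijk
        by (simp add: v_def composite_nonzero_def)
    next
      case 2
      then show ?thesis using True nonzero_arrow_self[OF Ob] Comp_Id_left[OF Hom_eq(3)[OF Ob Ob]] ijk
        by (simp add: v_def composite_nonzero_def)
    next
      case 3
      have "nonzero_arrow (l j) (l k) \<cdot> nonzero_arrow (l i) (l j) \<in>
          {zero (l i) (l k), nonzero_arrow (l i) (l k)}"
        using Hom_eq Comp_in_Hom Ob ijk by metis
      then show ?thesis using True 3 ijk
        by (auto simp: v_def composite_nonzero_def triples_def)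
    qed
  qed
  interpret K: category ?K by (rule category_model[OF compatible_triples[OF l]])
  have "cat_functor ?K C l F"
  proof
    show "F (Comp ?K g f) = F g \<cdot> F f" if "f \<in> Hom ?K x y" "g \<in> Hom ?K y z" for f g x y z
      using that by (auto simp: in_Hom_model F Comp)
    show "F f \<in> Hom C (l x) (l y)" if "f \<in> Hom ?K x y" for f x y
      using that v_Hom Ob by (auto simp: in_Hom_model F)
    show "F (Id ?K x) = Id C (l x)" if "x \<in> Ob ?K" for x
      using that nonzero_arrow_self Ob by (simp add: F v_def)
  qed (use Ob in auto)
  moreover have "bij_betw F (Arr ?K) (Arr C)"
  proof (rule bij_betw_imageI)
    have "i = i' \<and> j = j' \<and> b = b'"
      if "i < 3" "j < 3" "i' < 3" "j' < 3" "v b (l i) (l j) = v b' (l i') (l j')"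
      for i j b i' j' b'
    proof -
      have "v b (l i) (l j) \<in> Hom C (l i) (l j)" "v b' (l i') (l j') \<in> Hom C (l i') (l j')"
        using v_Hom Ob that by blast+
      then have "l i = l i'" "l j = l j'" using that(5) by (auto simp: Hom_def)
      then show ?thesis
        using that inj Hom_eq(2)[of "l i" "l j"] Ob by (auto simp: v_def split: if_splits)
    qed
    then show "inj_on F (Arr ?K)"
      by (intro inj_onI) (clarsimp simp: F)
    show "F ` Arr ?K = Arr C"
    proof
      show "F ` Arr ?K \<subseteq> Arr C"
        using v_Hom Ob by (auto simp: F Hom_def)
      show "Arr C \<subseteq> F ` Arr ?K"
      proof
        fix f assume f: "f \<in> Arr C"
        have "Dom C f \<in> l ` {..<3}" "Cod C f \<in> l ` {..<3}"
          using Dom_in_Ob[OF f] Cod_in_Ob[OF f] bij_betw_imp_surj_on[OF l] by simp_all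
        then obtain i j where ij: "i < 3" "j < 3" "Dom C f = l i" "Cod C f = l j"
          by blast
        then have "f \<in> {zero (l i) (l j), nonzero_arrow (l i) (l j)}"
          using f Hom_eq(1)[of "l i" "l j"] Ob by (auto simp: Hom_def)
        then have "f = F (arrow i j False) \<or> f = F (arrow i j True)"
          by (simp add: F v_def)
        then show "f \<in> F ` Arr ?K" using ij by fastforce
      qed
    qed
  qed
  ultimately have "isomorphic_cats ?K C"
    using l by (auto simp: isomorphic_cats_def)
  then show ?thesis by (rule isomorphic_cats_sym)
qed

end

lemma two_arrow_categoryI:
  assumes "C \<in> reduced_cats M23"
  shows "two_arrow_category C" "\<exists>l :: nat \<Rightarrow> _. bij_betw l {..<3} (Ob C)"
proof -
  obtain m :: "3 \<Rightarrow> _" where m: "bij_betw m UNIV (Ob C)"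
    and card: "\<And>i j. card (Hom C (m i) (m j)) = 2" and "category C" "reduced C"
    using assms by (auto simp: reduced_cats_def associated_def M23_def)
  interpret category C by fact
  have 3: "card (Ob C) = 3" "finite (Ob C)"
    using bij_betw_same_card[OF m] bij_betw_finite[OF m] by auto
  show "two_arrow_category C"
  proof
    show "card (Hom C x y) = 2" if "x \<in> Ob C" "y \<in> Ob C" for x y
      using that card m by (metis bij_betw_imp_surj_on imageE)
    show "\<exists>y \<in> Ob C. y \<noteq> x" if "x \<in> Ob C" for x
    proof (rule ccontr)
      assume "\<not> ?thesis"
      then have "Ob C = {x}" using that by blast
      then show False using 3 by simp
    qed
  qed fact
  show "\<exists>l :: nat \<Rightarrow> _. bij_betw l {..<3} (Ob C)"
    using 3 ex_bij_betw_nat_finite[of "Ob C"] by (simp add: lessThan_atLeast0)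
qed


section \<open>Classification of the compatible sets of triples\<close>

text \<open>
  One independent set of the hexagon for each orbit. The two-element sets consist of vertices at
  distance two and of opposite vertices, respectively.
\<close>

definition shapes :: "(nat \<times> nat \<times> nat) set set" where
  "shapes = {{}, {(0,1,2)}, {(0,1,2), (1,2,0)}, {(0,1,2), (2,1,0)}, {(0,1,2), (1,2,0), (2,0,1)}}"

lemma compatible_shapes:
  assumes "T \<in> shapes"
  shows "compatible T"
  using assms unfolding shapes_def by (elim insertE emptyE; simp add: compatible_def)

lemma distinct_triple_cases:
  assumes "compatible T" "(i, j, k) \<in> T"
  shows "(i, j, k) \<in> {(0,1,2), (0,2,1), (1,0,2), (1,2,0), (2,0,1), (2,1,0)}"
proof -
  have "i = 0 \<or> i = 1 \<or> i = 2" "j = 0 \<or> j = 1 \<or> j = 2" "k = 0 \<or> k = 1 \<or> k = 2"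
    using compatibleD(1-3)[OF assms] by linarith+
  then show ?thesis using compatibleD(4-6)[OF assms] by (elim disjE) simp_all
qed

definition reorder :: "nat \<Rightarrow> nat \<Rightarrow> nat \<Rightarrow> nat \<Rightarrow> nat" where
  "reorder x y z i = (if i = 0 then x else if i = 1 then y else z)"

lemma bij_reorder:
  assumes "x < 3" "y < 3" "z < 3" "x \<noteq> y" "y \<noteq> z" "x \<noteq> z"
  shows "bij_betw (reorder x y z) {..<3} {..<3}"
proof -
  have "{..<3::nat} = {0, 1, 2}" by auto
  moreover have "{x, y, z} = {..<3}"
    using assms by (intro card_subset_eq) auto
  ultimately show ?thesis using assms(4-6)
    by (simp add: bij_betw_def inj_on_def reorder_def insert_commute)
qed

text \<open>
  Next to \<open>012\<close>, an independent set can only contain \<open>120\<close>, \<open>210\<close> and \<open>201\<close>, which form a path.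
  The set \<open>{012, 201}\<close> is excluded by the last assumption, as it lies in the orbit of \<open>{012, 120}\<close>.
\<close>

lemma shape_of_set_with_012:
  assumes T: "compatible T" and 012: "(0,1,2) \<in> T" and first: "(2,0,1) \<in> T \<Longrightarrow> (1,2,0) \<in> T"
  shows "T \<in> shapes"
proof -
  have no: "(0,2,1) \<notin> T" "(1,0,2) \<notin> T" using compatibleD(7,8)[OF T 012] by auto
  consider "(1,2,0) \<in> T" "(2,0,1) \<in> T" | "(1,2,0) \<in> T" "(2,0,1) \<notin> T"
    | "(2,1,0) \<in> T" "(1,2,0) \<notin> T" "(2,0,1) \<notin> T"
    | "(2,1,0) \<notin> T" "(1,2,0) \<notin> T" "(2,0,1) \<notin> T"
    using first by blast
  then show ?thesis
  proof cases
    case 1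
    have "(2,1,0) \<notin> T" using compatibleD(8)[OF T 1(1)] by simp
    then have "T = {(0,1,2), (1,2,0), (2,0,1)}"
      using no 1 012 distinct_triple_cases[OF T] by fast
    then show ?thesis by (simp add: shapes_def)
  next
    case 2
    have "(2,1,0) \<notin> T" using compatibleD(8)[OF T 2(1)] by simp
    then have "T = {(0,1,2), (1,2,0)}"
      using no 2 012 distinct_triple_cases[OF T] by fast
    then show ?thesis by (simp add: shapes_def)
  next
    case 3
    then have "T = {(0,1,2), (2,1,0)}"
      using no 012 distinct_triple_cases[OF T] by fast
    then show ?thesis by (simp add: shapes_def)
  next
    case 4
    then have "T = {(0,1,2)}"
      using no 012 distinct_triple_cases[OF T] by fast
    then show ?thesis by (simp add: shapes_def)
  qed
qed

context two_arrow_category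
begin

lemma triples_comp:
  fixes p :: "nat \<Rightarrow> nat"
  assumes "p i < 3" "p j < 3" "p k < 3" "i < 3" "j < 3" "k < 3"
    and "inj_on p {..<3}"
  shows "(i, j, k) \<in> triples (l \<circ> p) \<longleftrightarrow> (p i, p j, p k) \<in> triples l"
  using assms by (auto simp: triples_def inj_on_def)

text \<open>
  The objects are renumbered so that a chosen element of the set of triples becomes \<open>(0, 1, 2)\<close>.
\<close>

lemma exists_shape:
  fixes l :: "nat \<Rightarrow> 'o"
  assumes l: "bij_betw l {..<3} (Ob C)"
  shows "\<exists>m. bij_betw m {..<3} (Ob C) \<and> triples m \<in> shapes"
proof (cases "triples l = {}")
  case True
  then show ?thesis using l by (auto simp: shapes_def)
next
  case False
  let ?T = "triples l"
  note T = compatible_triples[OF l]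
  \<comment> \<open>If \<open>(x, y, z)\<close> does not qualify, then its rotation \<open>(z, x, y)\<close> does.\<close>
  have "\<exists>x y z. (x, y, z) \<in> ?T \<and> ((z, x, y) \<in> ?T \<longrightarrow> (y, z, x) \<in> ?T)"
    using False by (metis equals0I prod_cases3)
  then obtain x y z where xyz: "(x, y, z) \<in> ?T" and first: "(z, x, y) \<in> ?T \<Longrightarrow> (y, z, x) \<in> ?T"
    by blast
  let ?p = "reorder x y z"
  have p: "bij_betw ?p {..<3} {..<3}"
    using bij_reorder compatibleD(1-6)[OF T xyz] by blast
  have m: "bij_betw (l \<circ> ?p) {..<3} (Ob C)" using bij_betw_trans[OF p l] .
  have pull: "(i, j, k) \<in> triples (l \<circ> ?p) \<longleftrightarrow> (?p i, ?p j, ?p k) \<in> ?T"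
    if "i < 3" "j < 3" "k < 3" for i j k
    using that p triples_comp[of ?p i j k l] compatibleD(1-3)[OF T xyz]
    by (auto simp: bij_betw_def reorder_def)
  have "triples (l \<circ> ?p) \<in> shapes"
    by (rule shape_of_set_with_012[OF compatible_triples[OF m]])
      (use xyz first in \<open>simp_all add: pull reorder_def\<close>)
  then show ?thesis using m by blast
qed

end

lemma reduced_cat_isomorphic_shape:
  assumes "C \<in> reduced_cats M23"
  shows "\<exists>T \<in> shapes. isomorphic_cats C (model T)"
proof -
  interpret two_arrow_category C by (rule two_arrow_categoryI[OF assms])
  obtain l :: "nat \<Rightarrow> _" where "bij_betw l {..<3} (Ob C)"
    using two_arrow_categoryI[OF assms] by blast
  then show ?thesis using exists_shape isomorphic_model by blast
qed


section \<open>Isomorphic models have the same invariants\<close>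

text \<open>
  An isomorphism preserves identities, hence also the non-identity endomorphisms. As composing with
  these yields the zeros, zeros go to zeros and nonzero arrows to nonzero arrows, and the vanishing
  of composites is preserved.
\<close>

lemma isomorphic_models_triples:
  assumes T: "compatible T" and U: "compatible U" and iso: "isomorphic_cats (model T) (model U)"
  shows "\<exists>p. inj_on p {..<3} \<and> U = (\<lambda>(x, y, z). (p x, p y, p z)) ` T"
proof -
  obtain p F where pF: "cat_functor (model T) (model U) p F"
    and bp: "bij_betw p {..<3} {..<3}" and bF: "bij_betw F (Arr (model T)) (Arr (model U))"
    using iso unfolding isomorphic_cats_def by auto
  interpret cat_functor "model T" "model U" p F by fact
  have p3: "p x < 3" if "x < 3" for x using bp that by (auto simp: bij_betw_def)
  have p_inj: "p x = p y \<longleftrightarrow> x = y" if "x < 3" "y < 3" for x y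
    using bp that by (auto simp: bij_betw_def inj_on_def)
  have shape: "\<exists>c. F (arrow x y b) = arrow (p x) (p y) c" if "x < 3" "y < 3" for x y b
    using Fa_in_Hom[of "arrow x y b" x y] that by (auto simp: in_Hom_model)
  have F_neq: "F (arrow x y True) \<noteq> F (arrow x y False)" if "x < 3" "y < 3" for x y
    using inj_onD[OF bij_betw_imp_inj_on[OF bF], of "arrow x y True" "arrow x y False"] that
    by auto
  have F_id: "F (arrow x x True) = arrow (p x) (p x) True" if "x < 3" for x
    using Fa_Id[of x] that by simp
  have F_e: "F (arrow x x False) = arrow (p x) (p x) False" if "x < 3" for x
    using shape[OF that that, of False] F_neq[OF that that] F_id[OF that]
    by (metis (full_types))
  have F_zero: "F (arrow x y False) = arrow (p x) (p y) False" if xy: "x < 3" "y < 3" for x y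
  proof -
    obtain c where c: "F (arrow x y False) = arrow (p x) (p y) c" using shape xy by blast
    have "F (Comp (model T) (arrow y y False) (arrow x y False)) =
        Comp (model U) (F (arrow y y False)) (F (arrow x y False))"
      by (rule Fa_Comp[of _ x y _ y]) (use xy in \<open>auto simp: in_Hom_model\<close>)
    then show ?thesis using c F_e xy by simp
  qed
  have F_arrow: "F (arrow x y b) = arrow (p x) (p y) b" if xy: "x < 3" "y < 3" for x y b
    using F_zero[OF xy] F_neq[OF xy] shape[OF xy, of b] by (cases b) auto
  have T_U: "(x, y, z) \<in> T \<longleftrightarrow> (p x, p y, p z) \<in> U"
    if xyz: "x < 3" "y < 3" "z < 3" and "x \<noteq> y" "y \<noteq> z" for x y z
  proof -
    have "F (Comp (model T) (arrow y z True) (arrow x y True)) =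
        Comp (model U) (F (arrow y z True)) (F (arrow x y True))"
      by (rule Fa_Comp[of _ x y _ z]) (use xyz in \<open>auto simp: in_Hom_model\<close>)
    then have "composite_nonzero T x y z = composite_nonzero U (p x) (p y) (p z)"
      using xyz by (simp add: F_arrow)
    then show ?thesis using that by (simp add: composite_nonzero_def p_inj)
  qed
  have "U = (\<lambda>(x, y, z). (p x, p y, p z)) ` T"
  proof
    show "(\<lambda>(x, y, z). (p x, p y, p z)) ` T \<subseteq> U"
    proof clarify
      fix x y z assume xyz: "(x, y, z) \<in> T"
      show "(p x, p y, p z) \<in> U"
        using T_U[OF compatibleD(1-5)[OF T xyz]] xyz by simp
    qed
    show "U \<subseteq> (\<lambda>(x, y, z). (p x, p y, p z)) ` T"
    proof clarify
      fix u v w assume uvw: "(u, v, w) \<in> U"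
      have "{u, v, w} \<subseteq> p ` {..<3}"
        using compatibleD(1-3)[OF U uvw] bp by (simp add: bij_betw_def)
      then obtain x y z where "x < 3" "y < 3" "z < 3" "u = p x" "v = p y" "w = p z" by auto
      then show "(u, v, w) \<in> (\<lambda>(x, y, z). (p x, p y, p z)) ` T"
        using T_U[of x y z] uvw compatibleD(4,5)[OF U uvw]
        by (intro image_eqI[of _ _ "(x, y, z)"]) auto
    qed
  qed
  then show ?thesis using bp by (auto simp: bij_betw_def)
qed

definition reversible :: "(nat \<times> nat \<times> nat) set \<Rightarrow> bool" where
  "reversible T \<longleftrightarrow> (\<exists>(x, y, z) \<in> T. (z, y, x) \<in> T)"

lemma isomorphic_models_invariants:
  assumes T: "compatible T" and U: "compatible U" and iso: "isomorphic_cats (model T) (model U)"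
  shows "card T = card U" "reversible T = reversible U"
proof -
  obtain p where p: "inj_on p {..<3}" and U_eq: "U = (\<lambda>(x, y, z). (p x, p y, p z)) ` T"
    using isomorphic_models_triples[OF assms] by blast
  have eq: "x = y" if "p x = p y" "x < 3" "y < 3" for x y
    using p that by (auto simp: inj_on_def)
  have "inj_on (\<lambda>(x, y, z). (p x, p y, p z)) T"
    using eq compatibleD(1-3)[OF T] by (auto simp: inj_on_def)
  then show "card T = card U" using U_eq by (simp add: card_image)
  show "reversible T = reversible U"
  proof
    show "reversible U" if "reversible T"
      using that unfolding reversible_def U_eq by force
    assume "reversible U"
    then obtain x y z x' y' z' where 1: "(x, y, z) \<in> T" and 2: "(x', y', z') \<in> T"
      and 3: "p x' = p z" "p y' = p y" "p z' = p x"
      unfolding reversible_def U_eq by auto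
    have "x' = z" "y' = y" "z' = x"
      using 3 eq compatibleD(1-3)[OF T 1] compatibleD(1-3)[OF T 2] by blast+
    then show "reversible T" using 1 2 unfolding reversible_def by blast
  qed
qed

text \<open>
  The cardinality alone does not separate the two shapes with two elements.
\<close>

lemma inj_on_shapes: "inj_on (\<lambda>T. (card T, reversible T)) shapes"
  unfolding shapes_def
  by (rule inj_onI) (elim insertE emptyE; simp add: reversible_def)

lemma isomorphic_shapes:
  assumes "T \<in> shapes" "U \<in> shapes" "isomorphic_cats (model T) (model U)"
  shows "T = U"
  using inj_onD[OF inj_on_shapes _ assms(1,2)] assms isomorphic_models_invariants compatible_shapes
  by simp

lemma card_shapes: "card shapes = 5"
proof -
  \<comment> \<open>The five shapes are counted through their invariants, which are easier to tell apart than
    sets of triples.\<close>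
  have "(\<lambda>T. (card T, reversible T)) ` shapes =
      {(0, False), (1, False), (2, False), (2, True), (3, False)}"
    by (simp add: shapes_def reversible_def eval_nat_numeral)
  then show ?thesis
    using card_image[OF inj_on_shapes] by simp
qed


section \<open>The count\<close>

theorem mainTheorem3:
  shows "(\<exists>S :: (nat, nat) cat set.
            card S = 5 \<and> S \<subseteq> reduced_cats M23 \<and>
            (\<forall>C\<in>S. \<forall>D\<in>S. C \<noteq> D \<longrightarrow> \<not> isomorphic_cats C D) \<and>
            (\<forall>C \<in> (reduced_cats M23 :: ('o, 'm) cat set). \<exists>D\<in>S. isomorphic_cats C D))
         \<and> Card_reduced M23 = 5"
proof -
  let ?S = "model ` shapes"
  let ?A = "reduced_cats M23 :: (nat, nat) cat set"
  let ?r = "{(C, D). C \<in> ?A \<and> D \<in> ?A \<and> isomorphic_cats C D}"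
  have cat: "category C" if "C \<in> ?A" for C
    using that by (simp add: reduced_cats_def associated_def)
  have S: "?S \<subseteq> ?A" using model_in_reduced_cats compatible_shapes by blast
  have distinct: "C = D" if "C \<in> ?S" "D \<in> ?S" "isomorphic_cats C D" for C D
    using that isomorphic_shapes by blast
  have "inj_on model shapes"
    using isomorphic_shapes isomorphic_cats_refl category_model compatible_shapes
    by (metis inj_onI)
  then have card_S: "card ?S = 5" by (simp add: card_image card_shapes)
  have "equiv ?A ?r"
    using isomorphic_cats_refl isomorphic_cats_sym isomorphic_cats_trans cat
    by (intro equivI refl_onI symI transI) blast+
  then have "card (?A // ?r) = card ?S"
  proof (rule card_quotient_representatives)
    show "\<exists>D \<in> ?S. (C, D) \<in> ?r" if "C \<in> ?A" for C
      using reduced_cat_isomorphic_shape[OF that] S that by blast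
  qed (use S distinct in auto)
  then have count: "Card_reduced M23 = 5" by (simp add: Card_reduced_def card_S)
  show ?thesis
  proof (intro conjI exI[of _ ?S])
    show "\<forall>C \<in> ?S. \<forall>D \<in> ?S. C \<noteq> D \<longrightarrow> \<not> isomorphic_cats C D"
      using distinct by blast
    show "\<forall>C \<in> (reduced_cats M23 :: ('o, 'm) cat set). \<exists>D \<in> ?S. isomorphic_cats C D"
      using reduced_cat_isomorphic_shape by blast
  qed (fact card_S S count)+
qed

end
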